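(* Let $X=x\frac{\partial}{\partial u}+y\frac{\partial}{\partial v}$ be a smooth vector field on an open set $D\subseteq\mathbb{R}^2$ with coordinates $(u,v)$, where $x,y$ are smooth functions on $D$, and let $\omega=-y\,du+x\,dv$. Let $P$ be a smooth vector field on $D$ which is an infinitesimal symmetry of $X$, i.e. there is a smooth function $\varphi$ on $D$ such that $\mathcal{L}_PX=\varphi X$ or $\mathcal{L}_P\omega=\varphi\,\omega$, and suppose that the function $\omega(P)$ vanishes nowhere on $D$. Then $\frac{1}{\omega(P)}$ is an integrating factor of $\omega$, i.e. the form $\frac{\omega}{\omega(P)}$ is closed, and consequently any function $I$ defined on an open subset of $D$ with $dI=\frac{\omega}{\omega(P)}$ there (such $I$ exist locally) is an invariant of $X$, i.e. $X(I)=0$.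
   Context: $\mathcal{L}_P$ denotes the Lie derivative along $P$; in particular $\mathcal{L}_PX=[P,X]$. *)

theory Defs
  imports "HOL-Analysis.Analysis"
begin

text \<open>
  Class \<open>C\<^sup>\<infinity>\<close> on an open set, by iterating directional derivatives in constant directions:
  \<open>k_diff_on (Suc n) S f\<close> asks that \<open>f\<close> be differentiable on \<open>S\<close> and that every directional
  derivative of \<open>f\<close> satisfy \<open>k_diff_on n S\<close>.
\<close>

primrec k_diff_on ::
  "nat \<Rightarrow> 'a::euclidean_space set \<Rightarrow> ('a \<Rightarrow> 'b::real_normed_vector) \<Rightarrow> bool" where
  "k_diff_on 0 S f \<longleftrightarrow> continuous_on S f"
| "k_diff_on (Suc n) S f \<longleftrightarrow>
     (\<forall>p\<in>S. f differentiable (at p)) \<and>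
     (\<forall>v. k_diff_on n S (\<lambda>p. frechet_derivative f (at p) v))"

definition smooth_on ::
  "'a::euclidean_space set \<Rightarrow> ('a \<Rightarrow> 'b::real_normed_vector) \<Rightarrow> bool" where
  "smooth_on S f \<longleftrightarrow> (\<forall>n. k_diff_on n S f)"

text \<open>
  A vector field on an open subset of \<open>'a\<close> is a map \<open>'a \<Rightarrow> 'a\<close> (the tangent vector being given
  by its components), a 1-form is a map \<open>'a \<Rightarrow> ('a \<Rightarrow>\<^sub>L real)\<close>; values outside the domain are
  irrelevant.
\<close>

definition deriv_along ::
  "('a::euclidean_space \<Rightarrow> 'a) \<Rightarrow> ('a \<Rightarrow> real) \<Rightarrow> 'a \<Rightarrow> real" where
  "deriv_along X f p = frechet_derivative f (at p) (X p)"

text \<open>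
  The Lie derivative \<open>[P, X]\<close>, with the sign convention \<open>[P, X] f = P (X f) - X (P f)\<close>.
\<close>

definition lie_bracket ::
  "('a::euclidean_space \<Rightarrow> 'a) \<Rightarrow> ('a \<Rightarrow> 'a) \<Rightarrow> 'a \<Rightarrow> 'a" where
  "lie_bracket P X p =
     frechet_derivative X (at p) (P p) - frechet_derivative P (at p) (X p)"

text \<open>
  The Lie derivative of a 1-form \<open>\<alpha>\<close> along \<open>P\<close>; in coordinates
  \<open>(L\<^sub>P \<alpha>)\<^sub>i = (\<Sum>j. P\<^sub>j \<partial>\<^sub>j \<alpha>\<^sub>i + \<alpha>\<^sub>j \<partial>\<^sub>i P\<^sub>j)\<close>.  The two lemmas below are its coordinate-free
  descriptions (Leibniz rule and Cartan's formula).
\<close>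

definition lie_deriv_form ::
  "('a::euclidean_space \<Rightarrow> 'a) \<Rightarrow> ('a \<Rightarrow> 'a \<Rightarrow>\<^sub>L real) \<Rightarrow> 'a \<Rightarrow> 'a \<Rightarrow>\<^sub>L real" where
  "lie_deriv_form P \<alpha> p =
     frechet_derivative \<alpha> (at p) (P p) + (\<alpha> p o\<^sub>L Blinfun (frechet_derivative P (at p)))"

definition ext_deriv ::
  "('a::euclidean_space \<Rightarrow> 'a \<Rightarrow>\<^sub>L real) \<Rightarrow> 'a \<Rightarrow> 'a \<Rightarrow> 'a \<Rightarrow> real" where
  "ext_deriv \<alpha> p v w =
     blinfun_apply (frechet_derivative \<alpha> (at p) v) w
     - blinfun_apply (frechet_derivative \<alpha> (at p) w) v"

definition form_apply ::
  "('a::euclidean_space \<Rightarrow> 'a \<Rightarrow>\<^sub>L real) \<Rightarrow> ('a \<Rightarrow> 'a) \<Rightarrow> 'a \<Rightarrow> real" where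
  "form_apply \<alpha> Y p = blinfun_apply (\<alpha> p) (Y p)"

lemma frechet_derivative_form_apply:
  assumes "\<alpha> differentiable (at p)" "Y differentiable (at p)"
  shows "frechet_derivative (form_apply \<alpha> Y) (at p) v =
    blinfun_apply (\<alpha> p) (frechet_derivative Y (at p) v)
    + blinfun_apply (frechet_derivative \<alpha> (at p) v) (Y p)"
proof -
  have "((\<lambda>q. blinfun_apply (\<alpha> q) (Y q)) has_derivative
     (\<lambda>v. blinfun_apply (\<alpha> p) (frechet_derivative Y (at p) v)
        + blinfun_apply (frechet_derivative \<alpha> (at p) v) (Y p))) (at p)"
    using assms by (intro bounded_bilinear.FDERIV[OF bounded_bilinear_blinfun_apply])
      (simp_all add: frechet_derivative_works[symmetric])
  from frechet_derivative_at[OF this] show ?thesis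
    unfolding form_apply_def[abs_def] by (metis (no_types, lifting))
qed

lemma lie_deriv_form_Leibniz:
  assumes "\<alpha> differentiable (at p)" "P differentiable (at p)" "Y differentiable (at p)"
  shows "form_apply (lie_deriv_form P \<alpha>) Y p =
    deriv_along P (form_apply \<alpha> Y) p - form_apply \<alpha> (lie_bracket P Y) p"
  using assms
  by (simp add: form_apply_def[of "lie_deriv_form P \<alpha>"] form_apply_def[of \<alpha> "lie_bracket P Y"]
      lie_deriv_form_def lie_bracket_def deriv_along_def frechet_derivative_form_apply
      blinfun.add_left blinfun.diff_right bounded_linear_Blinfun_apply
      linear_frechet_derivative linear_conv_bounded_linear[symmetric])

lemma lie_deriv_form_Cartan:
  assumes "\<alpha> differentiable (at p)" "P differentiable (at p)"
  shows "blinfun_apply (lie_deriv_form P \<alpha> p) w =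
    ext_deriv \<alpha> p (P p) w + frechet_derivative (form_apply \<alpha> P) (at p) w"
  using assms
  by (simp add: lie_deriv_form_def ext_deriv_def frechet_derivative_form_apply
      blinfun.add_left bounded_linear_Blinfun_apply
      linear_frechet_derivative linear_conv_bounded_linear[symmetric])

definition closed_form_on ::
  "'a::euclidean_space set \<Rightarrow> ('a \<Rightarrow> 'a \<Rightarrow>\<^sub>L real) \<Rightarrow> bool" where
  "closed_form_on D \<alpha> \<longleftrightarrow> smooth_on D \<alpha> \<and> (\<forall>p\<in>D. \<forall>v w. ext_deriv \<alpha> p v w = 0)"

definition integrating_factor_on ::
  "'a::euclidean_space set \<Rightarrow> ('a \<Rightarrow> real) \<Rightarrow> ('a \<Rightarrow> 'a \<Rightarrow>\<^sub>L real) \<Rightarrow> bool" where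
  "integrating_factor_on D \<mu> \<alpha> \<longleftrightarrow>
     smooth_on D \<mu> \<and> (\<forall>p\<in>D. \<mu> p \<noteq> 0) \<and> closed_form_on D (\<lambda>p. \<mu> p *\<^sub>R \<alpha> p)"

definition is_differential_on ::
  "'a::euclidean_space set \<Rightarrow> ('a \<Rightarrow> real) \<Rightarrow> ('a \<Rightarrow> 'a \<Rightarrow>\<^sub>L real) \<Rightarrow> bool" where
  "is_differential_on U I \<alpha> \<longleftrightarrow> (\<forall>p\<in>U. (I has_derivative blinfun_apply (\<alpha> p)) (at p))"

definition invariant_on ::
  "'a::euclidean_space set \<Rightarrow> ('a \<Rightarrow> 'a) \<Rightarrow> ('a \<Rightarrow> real) \<Rightarrow> bool" where
  "invariant_on U X I \<longleftrightarrow> (\<forall>p\<in>U. deriv_along X I p = 0)"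

text \<open>
  The plane with coordinates \<open>u = fst\<close>, \<open>v = snd\<close>: the field \<open>x \<partial>/\<partial>u + y \<partial>/\<partial>v\<close> and the form
  \<open>- y du + x dv\<close>.
\<close>

definition plane_field ::
  "(real \<times> real \<Rightarrow> real) \<Rightarrow> (real \<times> real \<Rightarrow> real) \<Rightarrow> real \<times> real \<Rightarrow> real \<times> real" where
  "plane_field x y p = x p *\<^sub>R (1, 0) + y p *\<^sub>R (0, 1)"

definition plane_form ::
  "(real \<times> real \<Rightarrow> real) \<Rightarrow> (real \<times> real \<Rightarrow> real) \<Rightarrow> real \<times> real \<Rightarrow> (real \<times> real) \<Rightarrow>\<^sub>L real" where
  "plane_form x y p = (- y p) *\<^sub>R fst_blinfun + x p *\<^sub>R snd_blinfun"

text \<open>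
  In the following definition \<open>\<omega>\<close> is meant to be the form \<open>- y du + x dv\<close> associated with
  \<open>X = x \<partial>/\<partial>u + y \<partial>/\<partial>v\<close>.
\<close>

definition infinitesimal_symmetry_on ::
  "(real \<times> real) set \<Rightarrow> (real \<times> real \<Rightarrow> real \<times> real) \<Rightarrow> (real \<times> real \<Rightarrow> real \<times> real) \<Rightarrow>
   (real \<times> real \<Rightarrow> (real \<times> real) \<Rightarrow>\<^sub>L real) \<Rightarrow> bool" where
  "infinitesimal_symmetry_on D P X \<omega> \<longleftrightarrow>
     (\<exists>\<phi>. smooth_on D \<phi> \<and>
       ((\<forall>p\<in>D. lie_bracket P X p = \<phi> p *\<^sub>R X p) \<or>
        (\<forall>p\<in>D. lie_deriv_form P \<omega> p = \<phi> p *\<^sub>R \<omega> p)))"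

end

theory Submission
  imports Defs
begin

text \<open>
  Since \<open>\<omega>(X) = 0\<close>, either symmetry condition gives \<open>\<omega>([P, X]) = 0\<close>, whence
  \<open>d\<omega>(X, P) = X(\<omega>(P))\<close> and so \<open>d(\<omega>/\<omega>(P))(X, P) = 0\<close>.  As \<open>\<omega>(P) = det(X, P)\<close> does not vanish,
  \<open>X\<close> and \<open>P\<close> span the tangent plane at every point, and an alternating form vanishing on them
  is zero.  Local potentials come from the Poincare lemma on balls.
\<close>

section \<open>Closure properties of smooth functions\<close>

text \<open>On an open set, functions that agree on the set agree near each of its points, so their
  derivatives coincide there and the induction passes to directional derivatives.\<close>

lemma k_diff_on_cong:
  assumes "open S" "k_diff_on n S f" "\<And>p. p \<in> S \<Longrightarrow> f p = g p"
  shows "k_diff_on n S g"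
  using assms(2,3)
proof (induction n arbitrary: f g)
  case 0
  then show ?case using continuous_on_cong[of S S f g] by simp
next
  case (Suc n)
  have d: "(g has_derivative frechet_derivative f (at p)) (at p)" if "p \<in> S" for p
    using Suc.prems that \<open>open S\<close>
    by (intro has_derivative_transform_within_open[of f _ p UNIV S g])
      (auto simp: frechet_derivative_works[symmetric])
  then have "frechet_derivative f (at p) = frechet_derivative g (at p)" if "p \<in> S" for p
    using that frechet_derivative_at by blast
  then have "k_diff_on n S (\<lambda>p. frechet_derivative g (at p) v)" for v
    using Suc.IH[of "\<lambda>p. frechet_derivative f (at p) v"] Suc.prems(1) by simp
  with d show ?case unfolding k_diff_on.simps(2) differentiable_def by blast
qed

text \<open>Replaces the choice-based \<open>frechet_derivative\<close> by an explicit formula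
  \<open>f'\<close>, valid only on \<open>S\<close>; the closure rules below use it in their
  induction steps.\<close>

lemma k_diff_on_SucI:
  assumes "open S" "\<And>p. p \<in> S \<Longrightarrow> (f has_derivative f' p) (at p)"
    and "\<And>v. k_diff_on n S (\<lambda>p. f' p v)"
  shows "k_diff_on (Suc n) S f"
proof -
  have "f' p = frechet_derivative f (at p)" if "p \<in> S" for p
    using assms(2)[OF that] by (rule frechet_derivative_at)
  then have "k_diff_on n S (\<lambda>p. frechet_derivative f (at p) v)" for v
    by (intro k_diff_on_cong[OF \<open>open S\<close> assms(3)[of v]]) simp
  with assms(2) show ?thesis unfolding k_diff_on.simps(2) differentiable_def by blast
qed

lemma k_diff_on_Suc_has_derivative:
  "k_diff_on (Suc n) S f \<Longrightarrow> p \<in> S \<Longrightarrow> (f has_derivative frechet_derivative f (at p)) (at p)"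
  by (simp add: frechet_derivative_works[symmetric])

text \<open>Continuity is demanded only at order 0, so the base case is that differentiability
  implies continuity; higher orders follow by applying the hypothesis to directional
  derivatives.\<close>

lemma k_diff_on_SucD: "k_diff_on (Suc n) S f \<Longrightarrow> k_diff_on n S f"
proof (induction n arbitrary: f)
  case 0
  then show ?case
    by (simp add: continuous_at_imp_continuous_on differentiable_imp_continuous_within)
next
  case (Suc n)
  then show ?case by (metis k_diff_on.simps(2))
qed

lemma k_diff_on_const: "open S \<Longrightarrow> k_diff_on n S (\<lambda>_. c)"
proof (induction n arbitrary: c)
  case (Suc n)
  show ?case
    by (rule k_diff_on_SucI[where f' = "\<lambda>_ _. 0"]) (use Suc in auto)
qed simp

lemma k_diff_on_add:
  assumes "open S" "k_diff_on n S f" "k_diff_on n S g"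
  shows "k_diff_on n S (\<lambda>p. f p + g p)"
  using assms(2,3)
proof (induction n arbitrary: f g)
  case 0
  then show ?case by (simp add: continuous_on_add)
next
  case (Suc n)
  note d = k_diff_on_Suc_has_derivative[OF Suc.prems(1)]
    k_diff_on_Suc_has_derivative[OF Suc.prems(2)]
  show ?case
    by (rule k_diff_on_SucI[OF \<open>open S\<close> has_derivative_add[OF d]]) (use Suc in auto)
qed

text \<open>The product rule gives a sum of two values of \<open>h\<close>, each with one argument
  differentiated. The induction hypothesis, general in \<open>f\<close> and \<open>g\<close>, covers
  both once the other argument is lowered by one order.\<close>

lemma k_diff_on_bilinear:
  assumes "bounded_bilinear h" "open S" "k_diff_on n S f" "k_diff_on n S g"
  shows "k_diff_on n S (\<lambda>p. h (f p) (g p))"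
  using assms(3,4)
proof (induction n arbitrary: f g)
  case 0
  then show ?case by (simp add: bounded_bilinear.continuous_on[OF assms(1)])
next
  case (Suc n)
  note d = k_diff_on_Suc_has_derivative[OF Suc.prems(1)]
    k_diff_on_Suc_has_derivative[OF Suc.prems(2)]
  show ?case
    by (rule k_diff_on_SucI[OF \<open>open S\<close> bounded_bilinear.FDERIV[OF assms(1) d]])
      (use Suc.prems k_diff_on_SucD[OF Suc.prems(1)] k_diff_on_SucD[OF Suc.prems(2)]
        in \<open>simp_all add: k_diff_on_add[OF \<open>open S\<close>] Suc.IH\<close>)
qed

text \<open>The derivative of 1/f is a product of 1/f, Df and 1/f up to sign, so the induction
  hypothesis for 1/f and the product rule suffice.\<close>

lemma k_diff_on_inverse:
  fixes f :: "'a::euclidean_space \<Rightarrow> real"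
  assumes "open S" "k_diff_on n S f" "\<And>p. p \<in> S \<Longrightarrow> f p \<noteq> 0"
  shows "k_diff_on n S (\<lambda>p. inverse (f p))"
  using assms(2)
proof (induction n)
  case 0
  then show ?case using assms(3) by (simp add: continuous_on_inverse)
next
  case (Suc n)
  note mult = k_diff_on_bilinear[OF bounded_bilinear_mult \<open>open S\<close>]
  \<comment> \<open>The sign is written as the constant factor \<open>- 1\<close>, so that closure
    under products and constants is enough.\<close>
  have "k_diff_on n S
      (\<lambda>p. - 1 * (inverse (f p) * frechet_derivative f (at p) v * inverse (f p)))" for v
    using Suc k_diff_on_SucD[OF Suc.prems]
    by (intro mult k_diff_on_const[OF \<open>open S\<close>]) auto
  then show ?case
    using assms(3) k_diff_on_Suc_has_derivative[OF Suc.prems]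
    by (intro k_diff_on_SucI[OF \<open>open S\<close>, where
          f' = "\<lambda>p v. - (inverse (f p) * frechet_derivative f (at p) v * inverse (f p))"])
      (auto intro: Deriv.has_derivative_inverse)
qed

section \<open>Passage from finite order to all orders\<close>

lemma smooth_on_const: "open S \<Longrightarrow> smooth_on S (\<lambda>_. c)"
  by (simp add: smooth_on_def k_diff_on_const)

lemma smooth_on_add:
  "open S \<Longrightarrow> smooth_on S f \<Longrightarrow> smooth_on S g \<Longrightarrow> smooth_on S (\<lambda>p. f p + g p)"
  by (simp add: smooth_on_def k_diff_on_add)

lemma smooth_on_bilinear:
  "bounded_bilinear h \<Longrightarrow> open S \<Longrightarrow> smooth_on S f \<Longrightarrow> smooth_on S g \<Longrightarrow>
    smooth_on S (\<lambda>p. h (f p) (g p))"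
  by (simp add: smooth_on_def k_diff_on_bilinear)

lemmas smooth_on_scaleR = smooth_on_bilinear[OF bounded_bilinear_scaleR]

lemma smooth_on_uminus: "open S \<Longrightarrow> smooth_on S f \<Longrightarrow> smooth_on S (\<lambda>p. - f p)"
  using smooth_on_scaleR[OF _ smooth_on_const, of S f "- 1"] by simp

lemma smooth_on_inverse:
  fixes f :: "'a::euclidean_space \<Rightarrow> real"
  shows "open S \<Longrightarrow> smooth_on S f \<Longrightarrow> (\<And>p. p \<in> S \<Longrightarrow> f p \<noteq> 0) \<Longrightarrow>
    smooth_on S (\<lambda>p. inverse (f p))"
  by (simp add: smooth_on_def k_diff_on_inverse)

text \<open>The derivatives in \<open>k_diff_on\<close> are taken in the whole space and do not
  depend on the set; restriction only shrinks the range of points.\<close>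

lemma smooth_on_subset: "smooth_on S f \<Longrightarrow> T \<subseteq> S \<Longrightarrow> smooth_on T f"
proof -
  have "k_diff_on n S f \<Longrightarrow> T \<subseteq> S \<Longrightarrow> k_diff_on n T f" for n
    by (induction n arbitrary: f) (auto intro: continuous_on_subset)
  then show "smooth_on S f \<Longrightarrow> T \<subseteq> S \<Longrightarrow> smooth_on T f"
    by (auto simp: smooth_on_def)
qed

lemma smooth_on_imp_differentiable:
  "smooth_on S f \<Longrightarrow> p \<in> S \<Longrightarrow> f differentiable (at p)"
  unfolding smooth_on_def by (metis k_diff_on.simps(2))

lemma smooth_on_form_apply:
  "open S \<Longrightarrow> smooth_on S \<alpha> \<Longrightarrow> smooth_on S Y \<Longrightarrow> smooth_on S (form_apply \<alpha> Y)"
  unfolding form_apply_def[abs_def] by (rule smooth_on_bilinear[OF bounded_bilinear_blinfun_apply])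

text \<open>The directional derivatives of \<open>I\<close> are the components of
  \<open>\<alpha>\<close>, so \<open>I\<close> has one order of differentiability more than
  \<open>\<alpha>\<close>.\<close>

lemma smooth_on_potential:
  assumes "open S" "smooth_on S \<alpha>" "is_differential_on S I \<alpha>"
  shows "smooth_on S I"
  unfolding smooth_on_def
proof
  fix n
  have "k_diff_on n S (\<lambda>p. blinfun_apply (\<alpha> p) v)" for v
    using k_diff_on_bilinear[OF bounded_bilinear_blinfun_apply \<open>open S\<close> _ k_diff_on_const] assms
    by (auto simp: smooth_on_def)
  then have "k_diff_on (Suc n) S I"
    using assms by (intro k_diff_on_SucI[OF \<open>open S\<close>]) (auto simp: is_differential_on_def)
  then show "k_diff_on n S I" by (rule k_diff_on_SucD)
qed

section \<open>The Poincare lemma on convex sets\<close>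

text \<open>The potential at q is the integral of \<open>\<alpha>\<close> along the segment from a
  base point p to q. Closedness turns the q-derivative of the integrand into a total t-derivative,
  which integrates to \<open>\<alpha> q\<close>.\<close>

lemma closed_form_on_convex_imp_potential:
  fixes \<alpha> :: "'a::euclidean_space \<Rightarrow> 'a \<Rightarrow>\<^sub>L real"
  assumes "open S" "convex S" "closed_form_on S \<alpha>"
  shows "\<exists>I. is_differential_on S I \<alpha>"
proof (cases "S = {}")
  case True
  then show ?thesis by (simp add: is_differential_on_def)
next
  case False
  then obtain p where "p \<in> S" by blast
  define c where "c q t = p + t *\<^sub>R (q - p)" for q t
  define A where "A q = frechet_derivative \<alpha> (at q)" for q
  have c_in: "c q t \<in> S" if "q \<in> S" "t \<in> {0..1}" for q t
    using convexD_alt[OF \<open>convex S\<close> \<open>p \<in> S\<close> \<open>q \<in> S\<close>, of t] that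
    by (simp add: c_def algebra_simps)
  have smooth: "smooth_on S \<alpha>" using assms(3) by (simp add: closed_form_on_def)
  have \<alpha>_deriv: "(\<alpha> has_derivative A q) (at q)" if "q \<in> S" for q
    using smooth_on_imp_differentiable[OF smooth that]
    by (simp add: A_def frechet_derivative_works)
  have A_lin: "linear (A q)" if "q \<in> S" for q
    using \<alpha>_deriv[OF that] has_derivative_linear by blast
  have A_sym: "blinfun_apply (A q v) w = blinfun_apply (A q w) v" if "q \<in> S" for q v w
    using assms(3) that by (simp add: closed_form_on_def ext_deriv_def A_def)
  have cont_A: "continuous_on S (\<lambda>q. A q b)" for b
  proof -
    have "k_diff_on (Suc 0) S \<alpha>" using smooth by (simp only: smooth_on_def)
    then show ?thesis by (simp add: A_def)
  qed
  have cont_\<alpha>: "continuous_on S \<alpha>"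
    using smooth k_diff_on.simps(1) unfolding smooth_on_def by blast
  \<comment> \<open>\<open>F\<close> is the integrand of the line integral. \<open>F'\<close> is
    both its derivative in q, after closedness is used, and the t-derivative of
    \<open>t *\<^sub>R \<alpha> (c q t)\<close>.\<close>
  define F where "F q t = blinfun_apply (\<alpha> (c q t)) (q - p)" for q t
  define F' where "F' q t = \<alpha> (c q t) + t *\<^sub>R A (c q t) (q - p)" for q t
  have F_deriv: "((\<lambda>q. F q t) has_derivative blinfun_apply (F' q t)) (at q within S)"
    if q: "q \<in> S" and t: "t \<in> cbox 0 1" for q t
  proof -
    have cS: "c q t \<in> S" using c_in q t by simp
    have "((\<lambda>q. c q t) has_derivative (\<lambda>w. t *\<^sub>R w)) (at q)"
      unfolding c_def by (auto intro!: derivative_eq_intros)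
    from has_derivative_compose[OF this \<alpha>_deriv[OF cS]]
    have "((\<lambda>q. \<alpha> (c q t)) has_derivative (\<lambda>w. A (c q t) (t *\<^sub>R w))) (at q)" .
    moreover have "((\<lambda>q. q - p) has_derivative (\<lambda>w. w)) (at q)"
      by (auto intro!: derivative_eq_intros)
    ultimately have "((\<lambda>q. F q t) has_derivative
        (\<lambda>w. blinfun_apply (\<alpha> (c q t)) w + blinfun_apply (A (c q t) (t *\<^sub>R w)) (q - p))) (at q)"
      unfolding F_def by (rule bounded_bilinear.FDERIV[OF bounded_bilinear_blinfun_apply])
    \<comment> \<open>Closedness swaps w with \<open>q - p\<close>; w then becomes the outer
      argument in both terms, and the derivative is a single bounded linear map, as the Leibniz rule
      requires.\<close>
    also have "(\<lambda>w. blinfun_apply (\<alpha> (c q t)) w + blinfun_apply (A (c q t) (t *\<^sub>R w)) (q - p))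
        = blinfun_apply (F' q t)"
      by (auto simp: F'_def blinfun.add_left blinfun.scaleR_left linear_cmul[OF A_lin[OF cS]]
          A_sym[OF cS, of _ "q - p"])
    finally show ?thesis by (rule has_derivative_at_withinI)
  qed
  have cont_c: "continuous_on (S \<times> cbox 0 1) (\<lambda>(q, t). c q t)"
    unfolding c_def split_beta by (intro continuous_intros)
  have c_img: "(\<lambda>(q, t). c q t) ` (S \<times> cbox 0 1) \<subseteq> S"
    using c_in by auto
  have cont_F': "continuous_on (S \<times> cbox 0 1) (\<lambda>(q, t). F' q t)"
  proof -
    \<comment> \<open>Continuity of \<open>A\<close> is known only for a fixed direction, while
      \<open>q - p\<close> moves; expanding in the basis leaves fixed directions with continuous
      coefficients.\<close>
    have eq: "F' q t = \<alpha> (c q t) + t *\<^sub>R (\<Sum>b\<in>Basis. ((q - p) \<bullet> b) *\<^sub>R A (c q t) b)"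
      if "q \<in> S" "t \<in> cbox 0 1" for q t
    proof -
      have l: "linear (A (c q t))" using that by (intro A_lin c_in) auto
      have "A (c q t) (q - p) = A (c q t) (\<Sum>b\<in>Basis. ((q - p) \<bullet> b) *\<^sub>R b)"
        by (simp only: euclidean_representation)
      also have "\<dots> = (\<Sum>b\<in>Basis. ((q - p) \<bullet> b) *\<^sub>R A (c q t) b)"
        by (simp only: linear_sum[OF l] linear_cmul[OF l])
      finally show ?thesis by (simp add: F'_def)
    qed
    note comp = continuous_on_compose2[OF _ cont_c c_img, unfolded split_beta]
    have "continuous_on (S \<times> cbox 0 1) (\<lambda>z. \<alpha> (c (fst z) (snd z)) +
        snd z *\<^sub>R (\<Sum>b\<in>Basis. ((fst z - p) \<bullet> b) *\<^sub>R A (c (fst z) (snd z)) b))"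
      by (intro continuous_intros comp[OF cont_\<alpha>] comp[OF cont_A])
    then show ?thesis
      by (rule continuous_on_eq) (auto simp: eq)
  qed
  have F_int: "F q integrable_on cbox 0 1" if "q \<in> S" for q
  proof -
    have "continuous_on (cbox 0 1) (c q)" unfolding c_def by (intro continuous_intros)
    then have "continuous_on (cbox 0 1) (\<lambda>t. \<alpha> (c q t))"
      using c_in[OF that] by (intro continuous_on_compose2[OF cont_\<alpha>]) auto
    then have "continuous_on (cbox 0 1) (F q)"
      unfolding F_def by (intro continuous_intros)
    then show ?thesis by (rule integrable_continuous)
  qed
  have F'_int: "integral (cbox 0 1) (F' q) = \<alpha> q" if q: "q \<in> S" for q
  proof -
    have "((\<lambda>t. t *\<^sub>R \<alpha> (c q t)) has_vector_derivative F' q t) (at t within {0..1})"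
      if t: "t \<in> {0..1}" for t
    proof -
      have cS: "c q t \<in> S" using c_in q t by simp
      have "(c q has_derivative (\<lambda>s. s *\<^sub>R (q - p))) (at t)"
        unfolding c_def by (auto intro!: derivative_eq_intros)
      from has_derivative_compose[OF this \<alpha>_deriv[OF cS]]
      have "((\<lambda>t. \<alpha> (c q t)) has_vector_derivative A (c q t) (q - p)) (at t)"
        by (simp add: has_vector_derivative_def linear_cmul[OF A_lin[OF cS]])
      then have "((\<lambda>t. t *\<^sub>R \<alpha> (c q t)) has_vector_derivative F' q t) (at t)"
        unfolding F'_def by (auto intro!: derivative_eq_intros)
      then show ?thesis by (rule has_vector_derivative_at_within)
    qed
    \<comment> \<open>The lower endpoint contributes nothing because of the factor t, and
      \<open>c q 1\<close> equals q.\<close>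
    from fundamental_theorem_of_calculus[OF _ this]
    have "(F' q has_integral 1 *\<^sub>R \<alpha> (c q 1) - 0 *\<^sub>R \<alpha> (c q 0)) {0..1}" by simp
    then show ?thesis by (simp add: c_def integral_unique)
  qed
  have "is_differential_on S (\<lambda>q. integral (cbox 0 1) (F q)) \<alpha>"
    unfolding is_differential_on_def
  proof
    fix q assume q: "q \<in> S"
    \<comment> \<open>Differentiation under the integral sign works within the convex set; openness
      then gives the full derivative.\<close>
    from leibniz_rule[OF F_deriv F_int cont_F' q \<open>convex S\<close>] F'_int[OF q]
    have "((\<lambda>q. integral (cbox 0 1) (F q)) has_derivative blinfun_apply (\<alpha> q)) (at q within S)"
      by simp
    then show "((\<lambda>q. integral (cbox 0 1) (F q)) has_derivative blinfun_apply (\<alpha> q)) (at q)"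
      using at_within_open[OF q \<open>open S\<close>] by simp
  qed
  then show ?thesis by blast
qed

section \<open>The integrating factor of an infinitesimal symmetry\<close>

text \<open>This is the identity d(\<mu>\<alpha>) = \<mu> d\<alpha> + d\<mu> \<and> \<alpha>,
  obtained by antisymmetrizing the product rule.\<close>

lemma ext_deriv_scaleR:
  assumes "\<mu> differentiable (at p)" "\<alpha> differentiable (at p)"
  shows "ext_deriv (\<lambda>q. \<mu> q *\<^sub>R \<alpha> q) p v w = \<mu> p * ext_deriv \<alpha> p v w
    + frechet_derivative \<mu> (at p) v * blinfun_apply (\<alpha> p) w
    - frechet_derivative \<mu> (at p) w * blinfun_apply (\<alpha> p) v"
proof -
  have "((\<lambda>q. \<mu> q *\<^sub>R \<alpha> q) has_derivative (\<lambda>v. \<mu> p *\<^sub>R frechet_derivative \<alpha> (at p) v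
      + frechet_derivative \<mu> (at p) v *\<^sub>R \<alpha> p)) (at p)"
    using assms by (intro has_derivative_scaleR) (simp_all add: frechet_derivative_works[symmetric])
  from frechet_derivative_at[OF this, symmetric] show ?thesis
    by (simp add: ext_deriv_def blinfun.add_left blinfun.scaleR_left algebra_simps)
qed

text \<open>The diagonal terms vanish and the mixed ones combine to the determinant of the
  coefficients. This reduces closedness in the plane to one pair of spanning vectors.\<close>

lemma ext_deriv_bilinear_alternating:
  assumes "\<alpha> differentiable (at p)"
  shows "ext_deriv \<alpha> p (a *\<^sub>R v + b *\<^sub>R w) (c *\<^sub>R v + d *\<^sub>R w) = (a * d - b * c) * ext_deriv \<alpha> p v w"
proof -
  note l = linear_frechet_derivative[OF assms]
  show ?thesis
    by (simp add: ext_deriv_def linear_add[OF l] linear_cmul[OF l] blinfun.add_left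
        blinfun.add_right blinfun.scaleR_left blinfun.scaleR_right algebra_simps)
qed

text \<open>Write f = \<alpha>(P) and \<mu> = 1/f. Then d\<alpha>(X, P) = X(f), so
  d(\<mu>\<alpha>)(X, P) = \<mu> X(f) + X(\<mu>) f - P(\<mu>) \<alpha>(X). The first two terms
  cancel and the last is zero.\<close>

lemma ext_deriv_normalized_form:
  fixes \<alpha> :: "'a::euclidean_space \<Rightarrow> 'a \<Rightarrow>\<^sub>L real"
  assumes "open S" "p \<in> S" "\<And>q. q \<in> S \<Longrightarrow> form_apply \<alpha> X q = 0"
    and diff: "\<alpha> differentiable (at p)" "X differentiable (at p)" "P differentiable (at p)"
    and "form_apply \<alpha> (lie_bracket P X) p = 0" "form_apply \<alpha> P p \<noteq> 0"
  shows "ext_deriv (\<lambda>q. inverse (form_apply \<alpha> P q) *\<^sub>R \<alpha> q) p (X p) (P p) = 0"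
proof -
  let ?f = "form_apply \<alpha> P"
  \<comment> \<open>\<alpha>(X) vanishes on a whole neighbourhood of p, so its derivative along P
    vanishes as well.\<close>
  have "(form_apply \<alpha> X has_derivative (\<lambda>_. 0)) (at p)"
    by (rule has_derivative_transform_within_open[OF has_derivative_const \<open>open S\<close> \<open>p \<in> S\<close>])
      (simp add: assms(3))
  from frechet_derivative_at[OF this, symmetric]
  have "blinfun_apply (\<alpha> p) (frechet_derivative X (at p) (P p))
      + blinfun_apply (frechet_derivative \<alpha> (at p) (P p)) (X p) = 0"
    using frechet_derivative_form_apply[OF diff(1,2), of "P p"] by simp
  \<comment> \<open>The bracket hypothesis lets \<alpha>(DX P) be exchanged for \<alpha>(DP X),
    which occurs in the derivative of \<alpha>(P) along X.\<close>
  then have d\<alpha>: "ext_deriv \<alpha> p (X p) (P p) = frechet_derivative ?f (at p) (X p)"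
    using assms(7) frechet_derivative_form_apply[OF diff(1,3), of "X p"]
    by (simp add: ext_deriv_def form_apply_def lie_bracket_def blinfun.diff_right)
  have f: "?f differentiable (at p)"
    unfolding form_apply_def[abs_def] differentiable_def
    using bounded_bilinear.FDERIV[OF bounded_bilinear_blinfun_apply] diff
    unfolding differentiable_def by blast
  have i: "((\<lambda>q. inverse (?f q)) has_derivative
      (\<lambda>v. - (inverse (?f p) * frechet_derivative ?f (at p) v * inverse (?f p)))) (at p)"
    using f assms(8) by (intro Deriv.has_derivative_inverse) (simp_all add: frechet_derivative_works)
  then have i_diff: "(\<lambda>q. inverse (?f q)) differentiable (at p)"
    by (auto simp: differentiable_def)
  have "blinfun_apply (\<alpha> p) (X p) = 0" "blinfun_apply (\<alpha> p) (P p) = ?f p"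
    using assms(3)[OF \<open>p \<in> S\<close>] by (simp_all add: form_apply_def)
  with assms(8) d\<alpha> show ?thesis
    by (simp add: ext_deriv_scaleR[OF i_diff diff(1)] frechet_derivative_at[OF i, symmetric])
qed

text \<open>If [P, X] is a multiple of X, then \<omega>(X) = 0 suffices. Otherwise the Leibniz rule
  gives \<omega>([P, X]) = P(\<omega>(X)) - \<phi> \<omega>(X), and both terms vanish.\<close>

lemma form_apply_lie_bracket_symmetry:
  assumes "open D" "p \<in> D" "\<And>q. q \<in> D \<Longrightarrow> form_apply \<omega> X q = 0"
    and "\<omega> differentiable (at p)" "X differentiable (at p)" "P differentiable (at p)"
    and "infinitesimal_symmetry_on D P X \<omega>"
  shows "form_apply \<omega> (lie_bracket P X) p = 0"
proof -
  from assms(7) obtain \<phi> where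
    "lie_bracket P X p = \<phi> p *\<^sub>R X p \<or> lie_deriv_form P \<omega> p = \<phi> p *\<^sub>R \<omega> p"
    using \<open>p \<in> D\<close> unfolding infinitesimal_symmetry_on_def by blast
  then show ?thesis
  proof
    assume "lie_bracket P X p = \<phi> p *\<^sub>R X p"
    then show ?thesis using assms(3)[OF \<open>p \<in> D\<close>]
      by (simp add: form_apply_def blinfun.scaleR_right)
  next
    assume L: "lie_deriv_form P \<omega> p = \<phi> p *\<^sub>R \<omega> p"
    have "(form_apply \<omega> X has_derivative (\<lambda>_. 0)) (at p)"
      by (rule has_derivative_transform_within_open[OF has_derivative_const assms(1,2)])
        (simp add: assms(3))
    from frechet_derivative_at[OF this, symmetric]
    have "deriv_along P (form_apply \<omega> X) p = 0" by (simp add: deriv_along_def)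
    then show ?thesis
      using lie_deriv_form_Leibniz[OF assms(4,6,5)] L assms(3)[OF \<open>p \<in> D\<close>]
      by (simp add: form_apply_def blinfun.scaleR_left)
  qed
qed

text \<open>The value is the determinant of (x, y) and Y; hence \<omega> annihilates X, and
  \<omega>(P) measures the independence of X and P.\<close>

lemma form_apply_plane_form:
  "form_apply (plane_form x y) Y p = x p * snd (Y p) - y p * fst (Y p)"
  by (simp add: form_apply_def plane_form_def blinfun.add_left
      blinfun.diff_left blinfun.scaleR_left blinfun.minus_left)

lemma form_apply_plane_form_plane_field: "form_apply (plane_form x y) (plane_field x y) p = 0"
  by (simp add: form_apply_plane_form plane_field_def)

text \<open>The coefficients are those of Cramer's rule.\<close>

lemma independent_pair_spans_plane:
  fixes a b v :: "real \<times> real"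
  assumes "fst a * snd b - snd a * fst b \<noteq> 0"
  obtains s t where "v = s *\<^sub>R a + t *\<^sub>R b"
proof
  let ?d = "fst a * snd b - snd a * fst b"
  show "v = ((fst v * snd b - snd v * fst b) / ?d) *\<^sub>R a
      + ((fst a * snd v - snd a * fst v) / ?d) *\<^sub>R b"
    using assms by (simp add: prod_eq_iff add_divide_distrib[symmetric] eq_divide_eq)
      (simp add: algebra_simps)
qed

theorem mainTheorem2:
  fixes D :: "(real \<times> real) set"
    and x y :: "real \<times> real \<Rightarrow> real"
    and P X :: "real \<times> real \<Rightarrow> real \<times> real"
    and \<omega> :: "real \<times> real \<Rightarrow> (real \<times> real) \<Rightarrow>\<^sub>L real"
  assumes "open D"
    and "smooth_on D x" and "smooth_on D y" and "smooth_on D P"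
    and "X = plane_field x y" and "\<omega> = plane_form x y"
    and "infinitesimal_symmetry_on D P X \<omega>"
    and "\<forall>p\<in>D. form_apply \<omega> P p \<noteq> 0"
  shows "integrating_factor_on D (\<lambda>p. 1 / form_apply \<omega> P p) \<omega>
    \<and> (\<forall>U I. open U \<and> U \<subseteq> D \<and>
          is_differential_on U I (\<lambda>p. (1 / form_apply \<omega> P p) *\<^sub>R \<omega> p)
        \<longrightarrow> invariant_on U X I)
    \<and> (\<forall>p\<in>D. \<exists>U I. open U \<and> p \<in> U \<and> U \<subseteq> D \<and> smooth_on U I \<and>
          is_differential_on U I (\<lambda>q. (1 / form_apply \<omega> P q) *\<^sub>R \<omega> q))"
proof -
  let ?\<mu> = "\<lambda>p. 1 / form_apply \<omega> P p"
  let ?\<beta> = "\<lambda>p. ?\<mu> p *\<^sub>R \<omega> p"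
  note smooth_intros = smooth_on_add smooth_on_scaleR smooth_on_uminus smooth_on_const
    \<open>open D\<close> \<open>smooth_on D x\<close> \<open>smooth_on D y\<close>
  have sX: "smooth_on D X"
    unfolding \<open>X = _\<close> plane_field_def[abs_def] by (intro smooth_intros)
  have s\<omega>: "smooth_on D \<omega>"
    unfolding \<open>\<omega> = _\<close> plane_form_def[abs_def] by (intro smooth_intros)
  have s\<mu>: "smooth_on D ?\<mu>"
    using smooth_on_inverse[OF \<open>open D\<close> smooth_on_form_apply[OF \<open>open D\<close> s\<omega> \<open>smooth_on D P\<close>]]
      assms(8) by (simp add: inverse_eq_divide)
  have s\<beta>: "smooth_on D ?\<beta>"
    by (rule smooth_on_scaleR[OF \<open>open D\<close> s\<mu> s\<omega>])
  have \<omega>X: "form_apply \<omega> X q = 0" for q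
    using assms(5,6) by (simp add: form_apply_plane_form_plane_field)
  have "ext_deriv ?\<beta> p v w = 0" if p: "p \<in> D" for p v w
  proof -
    note d = smooth_on_imp_differentiable[OF _ p]
    have XP: "ext_deriv ?\<beta> p (X p) (P p) = 0"
      using ext_deriv_normalized_form[OF \<open>open D\<close> p \<omega>X d[OF s\<omega>] d[OF sX] d[OF assms(4)]
          form_apply_lie_bracket_symmetry[OF \<open>open D\<close> p \<omega>X d[OF s\<omega>] d[OF sX] d[OF assms(4)]
            assms(7)]] assms(8) p
      by (simp add: inverse_eq_divide)
    have "fst (X p) * snd (P p) - snd (X p) * fst (P p) = form_apply \<omega> P p"
      using assms(5,6) by (simp add: form_apply_plane_form plane_field_def)
    with assms(8) p have ne: "fst (X p) * snd (P p) - snd (X p) * fst (P p) \<noteq> 0" by simp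
    obtain a b where v: "v = a *\<^sub>R X p + b *\<^sub>R P p"
      using independent_pair_spans_plane[OF ne] by blast
    obtain a' b' where w: "w = a' *\<^sub>R X p + b' *\<^sub>R P p"
      using independent_pair_spans_plane[OF ne] by blast
    \<comment> \<open>In the frame X, P the value at (v, w) is a determinant times the value at (X,
      P), which is zero.\<close>
    show ?thesis
      unfolding v w ext_deriv_bilinear_alternating[OF d[OF s\<beta>]] XP by simp
  qed
  with s\<beta> have closed: "closed_form_on D ?\<beta>" by (simp add: closed_form_on_def)
  have "integrating_factor_on D ?\<mu> \<omega>"
    using s\<mu> closed assms(8) by (simp add: integrating_factor_on_def)
  moreover have "invariant_on U X I" if "is_differential_on U I ?\<beta>" for U I
    unfolding invariant_on_def deriv_along_def
  proof
    fix p assume "p \<in> U"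
    with that have "(I has_derivative blinfun_apply (?\<beta> p)) (at p)"
      by (simp add: is_differential_on_def)
    \<comment> \<open>X(I) = dI(X) is a multiple of \<omega>(X), hence zero.\<close>
    from frechet_derivative_at[OF this, symmetric] \<omega>X[of p]
    show "frechet_derivative I (at p) (X p) = 0"
      by (simp add: form_apply_def blinfun.scaleR_left)
  qed
  moreover have "\<exists>U I. open U \<and> p \<in> U \<and> U \<subseteq> D \<and> smooth_on U I \<and> is_differential_on U I ?\<beta>"
    if "p \<in> D" for p
  proof -
    \<comment> \<open>A ball supplies the convex open neighbourhood on which closedness gives a
      potential.\<close>
    obtain e where e: "e > 0" "ball p e \<subseteq> D"
      using \<open>open D\<close> \<open>p \<in> D\<close> open_contains_ball by blast
    then have s: "smooth_on (ball p e) ?\<beta>" using s\<beta> smooth_on_subset by blast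
    with closed e have "closed_form_on (ball p e) ?\<beta>"
      unfolding closed_form_on_def by blast
    from closed_form_on_convex_imp_potential[OF open_ball convex_ball this]
    obtain I where I: "is_differential_on (ball p e) I ?\<beta>" by blast
    with smooth_on_potential[OF open_ball s I] e show ?thesis
      by (intro exI[of _ "ball p e"] exI[of _ I]) auto
  qed
  ultimately show ?thesis by blast
qed

end
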